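(* Let $(X,\mu)$ be a weighted graph such that, for some $\delta>0$, $\sup_{x\in X}P_x(M<T_x^+<+\infty)=O(M^{-1-\delta})$ as $M\to\infty$. Then for any $x\in X$, $$1-F_2\le\liminf_{n\to\infty}\frac{R_n}{n}\le\limsup_{n\to\infty}\frac{R_n}{n}\le1-F_1,\qquad P_x\text{-a.s.}$$
   Context: A weighted graph $(X,\mu)$ is an infinite connected graph $X$ with a symmetric function $\mu:X\times X\to[0,\infty)$, $(x,y)\mapsto\mu_{xy}$, such that $\mu_{xy}>0$ if and only if $x\sim y$ (i.e. $x$ and $y$ are joined by an edge). Standing assumptions: $\sup_{x\in X}\deg(x)<+\infty$ and $0<\inf_{x\sim y}\mu_{xy}\le\sup_{x\sim y}\mu_{xy}<+\infty$. Put $\mu_x=\sum_{y\in X}\mu_{xy}$. $\{S_n\}_{n\ge0}$ is the Markov chain on $X$ with transition probabilities $P(S_{n+1}=y\mid S_n=x)=\mu_{xy}/\mu_x$; $P_x$ is its law when $S_0=x$. The range is $R_n=|\{S_0,\dots,S_{n-1}\}|$. Let $T_x^+=\inf\{n\ge1:S_n=x\}$, $F_1=\inf_{x\in X}P_x(T_x^+<+\infty)$, $F_2=\sup_{x\in X}P_x(T_x^+<+\infty)$. *)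

theory Defs
  imports "HOL-Probability.Probability" "HOL-Library.Landau_Symbols"
begin

definition neighbours :: "'a set \<Rightarrow> ('a \<Rightarrow> 'a \<Rightarrow> bool) \<Rightarrow> 'a \<Rightarrow> 'a set" where
  "neighbours X E x = {y \<in> X. E x y}"

definition edge_weights :: "'a set \<Rightarrow> ('a \<Rightarrow> 'a \<Rightarrow> bool) \<Rightarrow> ('a \<Rightarrow> 'a \<Rightarrow> real) \<Rightarrow> real set" where
  "edge_weights X E \<mu> = {\<mu> x y | x y. x \<in> X \<and> y \<in> X \<and> E x y}"

text \<open>
  Weighted graphs together with the standing assumptions of bounded degree and of weights
  bounded away from zero and infinity. Loops are not excluded. Finiteness of the neighbourhoods
  is stated separately because the cardinality of an infinite set is 0.
\<close>

locale weighted_graph =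
  fixes X :: "'a set" and E :: "'a \<Rightarrow> 'a \<Rightarrow> bool" and \<mu> :: "'a \<Rightarrow> 'a \<Rightarrow> real"
  assumes infinite_vertices: "infinite X"
    and adj_sym: "\<lbrakk>x \<in> X; y \<in> X; E x y\<rbrakk> \<Longrightarrow> E y x"
    and connected_graph: "\<lbrakk>x \<in> X; y \<in> X\<rbrakk> \<Longrightarrow> (x, y) \<in> {(u, v). u \<in> X \<and> v \<in> X \<and> E u v}\<^sup>*"
    and weight_nonneg: "\<lbrakk>x \<in> X; y \<in> X\<rbrakk> \<Longrightarrow> 0 \<le> \<mu> x y"
    and weight_sym: "\<lbrakk>x \<in> X; y \<in> X\<rbrakk> \<Longrightarrow> \<mu> x y = \<mu> y x"
    and weight_pos_iff: "\<lbrakk>x \<in> X; y \<in> X\<rbrakk> \<Longrightarrow> 0 < \<mu> x y \<longleftrightarrow> E x y"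
    and locally_finite: "x \<in> X \<Longrightarrow> finite (neighbours X E x)"
    and degree_bounded: "bdd_above ((\<lambda>x. card (neighbours X E x)) ` X)"
    and weights_away_from_zero: "0 < Inf (edge_weights X E \<mu>)"
    and weights_bounded: "bdd_above (edge_weights X E \<mu>)"

text \<open>The weight \<open>\<mu>\<^sub>x\<close> of a vertex; \<open>X\<close> is infinite, hence the unordered infinite sum.\<close>

definition vertex_weight :: "'a set \<Rightarrow> ('a \<Rightarrow> 'a \<Rightarrow> real) \<Rightarrow> 'a \<Rightarrow> real" where
  "vertex_weight X \<mu> x = (\<Sum>\<^sub>\<infinity>y\<in>X. \<mu> x y)"

text \<open>
  Under each \<open>P x\<close> with \<open>x \<in> X\<close>, the process \<open>S\<close> is the time-homogeneous Markov chain on \<open>X\<close>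
  started at \<open>x\<close>. The probability spaces \<open>P x\<close> are arbitrary.
\<close>

locale random_walk =
  fixes X :: "'a set" and \<mu> :: "'a \<Rightarrow> 'a \<Rightarrow> real"
    and P :: "'a \<Rightarrow> 'w measure" and S :: "nat \<Rightarrow> 'w \<Rightarrow> 'a"
  assumes prob_space_P: "x \<in> X \<Longrightarrow> prob_space (P x)"
    and measurable_S: "x \<in> X \<Longrightarrow> S n \<in> measurable (P x) (count_space X)"
    and start: "x \<in> X \<Longrightarrow> \<P>(\<omega> in P x. S 0 \<omega> = x) = 1"
    and markov: "\<lbrakk>x \<in> X; \<And>i. i \<le> n \<Longrightarrow> s i \<in> X; y \<in> X;
        \<P>(\<omega> in P x. \<forall>i\<le>n. S i \<omega> = s i) > 0\<rbrakk> \<Longrightarrow>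
      \<P>(\<omega> in P x. S (Suc n) \<omega> = y \<bar> \<forall>i\<le>n. S i \<omega> = s i) = \<mu> (s n) y / vertex_weight X \<mu> (s n)"

definition walk_range :: "(nat \<Rightarrow> 'w \<Rightarrow> 'a) \<Rightarrow> nat \<Rightarrow> 'w \<Rightarrow> nat" where
  "walk_range S n \<omega> = card ((\<lambda>k. S k \<omega>) ` {..<n})"

text \<open>The infimum is taken in \<^typ>\<open>enat\<close>, so it is \<open>\<infinity>\<close> if there is no return to \<open>x\<close>.\<close>

definition return_time :: "(nat \<Rightarrow> 'w \<Rightarrow> 'a) \<Rightarrow> 'a \<Rightarrow> 'w \<Rightarrow> enat" where
  "return_time S x \<omega> = (INF n\<in>{n. 1 \<le> n \<and> S n \<omega> = x}. enat n)"

definition F1 :: "'a set \<Rightarrow> ('a \<Rightarrow> 'w measure) \<Rightarrow> (nat \<Rightarrow> 'w \<Rightarrow> 'a) \<Rightarrow> real" where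
  "F1 X P S = (INF x\<in>X. \<P>(\<omega> in P x. return_time S x \<omega> < \<infinity>))"

definition F2 :: "'a set \<Rightarrow> ('a \<Rightarrow> 'w measure) \<Rightarrow> (nat \<Rightarrow> 'w \<Rightarrow> 'a) \<Rightarrow> real" where
  "F2 X P S = (SUP x\<in>X. \<P>(\<omega> in P x. return_time S x \<omega> < \<infinity>))"

end

theory Submission
  imports Defs "HOL-Library.Discrete_Functions"
begin

text \<open>
  Write \<open>p z\<close> for the return probability of \<open>z\<close>, \<open>Y i\<close> for the indicator of a return to
  \<open>S i\<close> after time \<open>i\<close>, and \<open>H i m\<close> for the indicator that such a return happens, for the first
  time more than \<open>m\<close> steps after time \<open>i\<close>. Counting each visited point at its last visit before time \<open>n\<close> shows that the
  range is \<open>\<Sum>i<n. 1 - Y i + H i (n - 1 - i)\<close>.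

  Given the path up to time \<open>i\<close>, the expectation of \<open>Y i\<close> is \<open>p (S i)\<close>. For \<open>i < j\<close>, the
  variable \<open>p (S i) - Y i\<close> is determined by the path up to time \<open>j\<close> up to the term
  \<open>H i (j - i)\<close>, whose mean is at most
  \<open>\<epsilon> (j - i) = (SUP z. P z (j - i < T z < \<infinity>))\<close>; hence the covariance with
  \<open>p (S j) - Y j\<close> is at most \<open>\<epsilon> (j - i)\<close>. As \<open>\<epsilon>\<close> is summable, the second moment of
  the range minus \<open>\<Sum>i<n. 1 - p (S i)\<close> is \<open>O(n)\<close>. This difference changes by at most 1 in each
  step, so by convergence along the squares it is almost surely \<open>o(n)\<close>, while the average of
  \<open>1 - p (S i)\<close> lies between \<open>1 - F2\<close> and \<open>1 - F1\<close>.
\<close>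

section \<open>Countable partitions, and almost sure convergence from second moments\<close>

text \<open>Integrability makes the set integral countably additive. The cells will be the events
  that fix the path up to a given time, which replaces conditional expectations.\<close>

lemma (in finite_measure) integral_eq_0_if_countable_partition:
  fixes f :: "'a \<Rightarrow> real"
  assumes f: "integrable M f" and "countable I"
    and meas: "\<And>i. i \<in> I \<Longrightarrow> A i \<in> sets M" and disj: "disjoint_family_on A I"
    and cover: "space M = (\<Union>i\<in>I. A i)"
    and zero: "\<And>i. i \<in> I \<Longrightarrow> (\<integral>\<omega>. indicator (A i) \<omega> * f \<omega> \<partial>M) = 0"
  shows "(\<integral>\<omega>. f \<omega> \<partial>M) = 0"
proof -
  define B where "B k = (\<Union>i\<in>{i\<in>I. to_nat_on I i = k}. A i)" for k
  have inj: "inj_on (to_nat_on I) I"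
    using \<open>countable I\<close> by (rule inj_on_to_nat_on)
  have B: "B k = {} \<or> (\<exists>i\<in>I. B k = A i)" for k
  proof (cases "\<exists>i\<in>I. to_nat_on I i = k")
    case True
    then obtain i where i: "i \<in> I" "to_nat_on I i = k" by blast
    then have "{i\<in>I. to_nat_on I i = k} = {i}"
      using inj by (auto simp: inj_on_def)
    then show ?thesis using i by (auto simp: B_def)
  qed (auto simp: B_def)
  have sets: "B k \<in> sets M" for k
    using B[of k] meas by auto
  have UB: "(\<Union>k. B k) = space M"
    by (auto simp: B_def cover)
  have disjB: "B k \<inter> B l = {}" if "k \<noteq> l" for k l
  proof -
    have "A i \<inter> A j = {}" if "i \<in> I" "j \<in> I" "to_nat_on I i = k" "to_nat_on I j = l" for i j
      using that \<open>k \<noteq> l\<close> by (intro disjoint_family_onD[OF disj]) auto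
    then show ?thesis
      by (simp add: B_def Int_UN_distrib2)
  qed
  have "(LINT \<omega>:(\<Union>k. B k)|M. f \<omega>) = (\<Sum>k. (LINT \<omega>:(B k)|M. f \<omega>))"
  proof (rule lebesgue_integral_countable_add)
    show "set_integrable M (\<Union>k. B k) f"
      unfolding UB set_integrable_def using f by (intro integrable_mult_indicator) auto
  qed (auto simp: sets disjB)
  also have "(LINT \<omega>:(B k)|M. f \<omega>) = 0" for k
    using B[of k] zero by (auto simp: set_lebesgue_integral_def)
  then have "(\<Sum>k. (LINT \<omega>:(B k)|M. f \<omega>)) = 0"
    by simp
  finally show ?thesis
    using f by (simp add: UB set_integral_space)
qed

lemma abs_diff_le_if_abs_Suc_diff_le:
  fixes u :: "nat \<Rightarrow> real"
  assumes "\<And>n. \<bar>u (Suc n) - u n\<bar> \<le> 1"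
  shows "\<bar>u (m + k) - u m\<bar> \<le> real k"
proof (induction k)
  case (Suc k)
  then show ?case using assms[of "m + k"] by simp
qed simp

text \<open>For \<open>k = floor_sqrt n\<close> the square \<open>k^2\<close> is at distance at most
  \<open>2 * k\<close> from \<open>n\<close>. With unit steps \<open>u\<close> moves by at most
  \<open>2 * k\<close> in between, which is negligible against \<open>k^2\<close>.\<close>

lemma tendsto_0_if_tendsto_0_on_squares:
  fixes u :: "nat \<Rightarrow> real"
  assumes step: "\<And>n. \<bar>u (Suc n) - u n\<bar> \<le> 1"
    and squares: "(\<lambda>k. u (k\<^sup>2) / real (k\<^sup>2)) \<longlonglongrightarrow> 0"
  shows "(\<lambda>n. u n / real n) \<longlonglongrightarrow> 0"
proof (rule Lim_null_comparison)
  have fs: "filterlim floor_sqrt at_top sequentially"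
    unfolding filterlim_at_top
  proof
    fix Z show "\<forall>\<^sub>F n in sequentially. Z \<le> floor_sqrt n"
      using eventually_ge_at_top[of "Z\<^sup>2"] by eventually_elim (rule le_floor_sqrtI)
  qed
  define v where "v k = \<bar>u (k\<^sup>2) / real (k\<^sup>2)\<bar> + 2 / real k" for k
  have "(\<lambda>k. 2 / real k) \<longlonglongrightarrow> 0"
    by (rule lim_const_over_n)
  then have "v \<longlonglongrightarrow> 0"
    unfolding v_def using tendsto_add[OF tendsto_rabs_zero[OF squares]] by fastforce
  then show "(\<lambda>n. v (floor_sqrt n)) \<longlonglongrightarrow> 0"
    using fs by (rule filterlim_compose)
  show "\<forall>\<^sub>F n in sequentially. norm (u n / real n) \<le> v (floor_sqrt n)"
    using eventually_gt_at_top[of 0]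
  proof eventually_elim
    case (elim n)
    define k where "k = floor_sqrt n"
    have k: "0 < k" "k\<^sup>2 \<le> n" "n < (Suc k)\<^sup>2"
      using elim Suc_floor_sqrt_power2_gt by (auto simp: k_def)
    have d: "n - k\<^sup>2 \<le> 2 * k"
      using k by (simp add: power2_eq_square)
    have "\<bar>u n - u (k\<^sup>2)\<bar> \<le> real (n - k\<^sup>2)"
      using abs_diff_le_if_abs_Suc_diff_le[of u "k\<^sup>2" "n - k\<^sup>2"] step k by simp
    also have "\<dots> \<le> 2 * real k"
      using d by (metis of_nat_le_iff of_nat_mult of_nat_numeral)
    finally have "\<bar>u n\<bar> \<le> \<bar>u (k\<^sup>2)\<bar> + 2 * real k"
      by linarith
    moreover have "real (k\<^sup>2) \<le> real n" "0 < real (k\<^sup>2)"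
      using k by (auto simp del: of_nat_power)
    ultimately have "\<bar>u n\<bar> / real n \<le> (\<bar>u (k\<^sup>2)\<bar> + 2 * real k) / real (k\<^sup>2)"
      by (intro frac_le) auto
    also have "\<dots> = v k"
      using k by (simp add: v_def add_divide_distrib power2_eq_square)
    finally show ?case
      by (simp add: k_def)
  qed
qed

text \<open>Along \<open>n = k^2\<close> the second moments of \<open>U n / n\<close> are at most
  \<open>K / k^2\<close>, hence summable, so the squared ratios are almost surely summable and tend
  to 0. The unit steps fill the gaps between squares.\<close>

lemma (in prob_space) AE_tendsto_0_if_second_moment_linear:
  fixes U :: "nat \<Rightarrow> 'a \<Rightarrow> real"
  assumes int: "\<And>n. integrable M (\<lambda>\<omega>. (U n \<omega>)\<^sup>2)"
    and moment: "\<And>n. expectation (\<lambda>\<omega>. (U n \<omega>)\<^sup>2) \<le> K * real n"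
    and step: "\<And>n \<omega>. \<omega> \<in> space M \<Longrightarrow> \<bar>U (Suc n) \<omega> - U n \<omega>\<bar> \<le> 1"
  shows "AE \<omega> in M. (\<lambda>n. U n \<omega> / real n) \<longlonglongrightarrow> 0"
proof -
  define g where "g k \<omega> = (U (k\<^sup>2) \<omega> / real (k\<^sup>2))\<^sup>2" for k \<omega>
  have g_eq: "g k = (\<lambda>\<omega>. (U (k\<^sup>2) \<omega>)\<^sup>2 / (real (k\<^sup>2))\<^sup>2)" for k
    by (simp add: g_def power_divide fun_eq_iff)
  have g_int: "integrable M (g k)" for k
    unfolding g_eq using int[of "k\<^sup>2"] by simp
  \<comment> \<open>For \<open>k = 0\<close> both sides are 0, as division by zero yields
    zero.\<close>
  have g_le: "expectation (g k) \<le> K * (1 / real k ^ 2)" for k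
  proof (cases "k = 0")
    case False
    have "expectation (g k) = expectation (\<lambda>\<omega>. (U (k\<^sup>2) \<omega>)\<^sup>2) / (real (k\<^sup>2))\<^sup>2"
      unfolding g_eq by simp
    also have "\<dots> \<le> K * real (k\<^sup>2) / (real (k\<^sup>2))\<^sup>2"
      by (intro divide_right_mono moment) auto
    also have "\<dots> = K * (1 / real k ^ 2)"
      using False by (simp add: power2_eq_square)
    finally show ?thesis .
  qed (simp add: g_eq)
  have nonneg: "0 \<le> expectation (g k)" for k
    by (rule Bochner_Integration.integral_nonneg) (simp add: g_def)
  have "summable (\<lambda>k. K * (1 / real k ^ 2))"
    using inverse_power_summable[of 2, where 'a = real] by (intro summable_mult) (simp add: inverse_eq_divide)
  then have sm: "summable (\<lambda>k. expectation (g k))"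
    by (rule summable_comparison_test') (use g_le nonneg in auto)
  have meas[measurable]: "g k \<in> borel_measurable M" for k
    using g_int by auto
  have "(\<integral>\<^sup>+\<omega>. (\<Sum>k. ennreal (g k \<omega>)) \<partial>M) = (\<Sum>k. \<integral>\<^sup>+\<omega>. ennreal (g k \<omega>) \<partial>M)"
    by (intro nn_integral_suminf) measurable
  also have "\<dots> = (\<Sum>k. ennreal (expectation (g k)))"
    by (intro suminf_cong nn_integral_eq_integral g_int) (simp add: g_def)
  also have "\<dots> \<noteq> \<infinity>"
    using sm nonneg by (simp add: suminf_ennreal2)
  finally have "AE \<omega> in M. (\<Sum>k. ennreal (g k \<omega>)) \<noteq> \<infinity>"
    by (intro nn_integral_PInf_AE) measurable
  then show ?thesis
    using AE_space
  proof eventually_elim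
    case (elim \<omega>)
    have "summable (\<lambda>k. g k \<omega>)"
      using elim by (intro summable_suminf_not_top) (auto simp: g_def)
    then have "(\<lambda>k. g k \<omega>) \<longlonglongrightarrow> 0"
      by (rule summable_LIMSEQ_zero)
    then have "(\<lambda>k. U (k\<^sup>2) \<omega> / real (k\<^sup>2)) \<longlonglongrightarrow> 0"
      unfolding g_def using tendsto_power_zero by (simp del: of_nat_power)
    then show ?case
      using step elim by (intro tendsto_0_if_tendsto_0_on_squares) auto
  qed
qed

section \<open>Returns of a single path, and the last-visit formula for the range\<close>

text \<open>A predicate on bare sequences, so that it applies to the walk shifted by any
  \<open>i\<close> without naming a target vertex.\<close>

definition first_return :: "(nat \<Rightarrow> 'a) \<Rightarrow> nat \<Rightarrow> bool" where
  "first_return f k \<longleftrightarrow> 0 < k \<and> f k = f 0 \<and> (\<forall>l. 0 < l \<and> l < k \<longrightarrow> f l \<noteq> f 0)"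

text \<open>The pathwise form of \<open>m < T < \<infinity>\<close>. For \<open>m = 0\<close> it is
  the event of returning at all, as first returns have positive times.\<close>

definition late_return :: "(nat \<Rightarrow> 'a) \<Rightarrow> nat \<Rightarrow> bool" where
  "late_return f m \<longleftrightarrow> (\<exists>k>m. first_return f k)"

lemma first_return_unique: "first_return f k \<Longrightarrow> first_return f l \<Longrightarrow> k = l"
  using linorder_cases[of k l] by (auto simp: first_return_def)

text \<open>This locality makes first-return events admissible in
  \<open>emeasure_path_future\<close>; \<open>late_return\<close> itself involves infinitely many
  coordinates.\<close>

lemma first_return_cong:
  assumes "\<And>i. i \<le> k \<Longrightarrow> f i = g i"
  shows "first_return f k \<longleftrightarrow> first_return g k"
  using assms by (auto simp: first_return_def)

lemma first_return_exists:
  assumes "0 < k" "f k = f 0"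
  obtains l where "l \<le> k" "first_return f l"
proof
  define l where "l = (LEAST l. 0 < l \<and> f l = f 0)"
  have "0 < l \<and> f l = f 0"
    unfolding l_def by (rule LeastI[of _ k]) (use assms in auto)
  moreover have "\<not> (0 < j \<and> f j = f 0)" if "j < l" for j
    using not_less_Least[of j "\<lambda>l. 0 < l \<and> f l = f 0"] that unfolding l_def by blast
  ultimately show "first_return f l"
    by (auto simp: first_return_def)
  show "l \<le> k"
    unfolding l_def by (rule Least_le) (use assms in auto)
qed

text \<open>The first return is unique, so one within \<open>m\<close> steps excludes one after
  \<open>m\<close>. An event of finitely many steps is thus expressed through two return events with
  known conditional probabilities.\<close>

lemma return_within_iff:
  "(\<exists>k. 0 < k \<and> k \<le> m \<and> f k = f 0) \<longleftrightarrow> late_return f 0 \<and> \<not> late_return f m"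
proof safe
  fix k assume k: "0 < k" "k \<le> m" "f k = f 0"
  obtain l where l: "l \<le> k" "first_return f l"
    using k first_return_exists by metis
  then show "late_return f 0"
    by (auto simp: late_return_def first_return_def)
  assume "late_return f m"
  then obtain j where "j > m" "first_return f j"
    by (auto simp: late_return_def)
  with l k first_return_unique[of f l j] show False
    by simp
next
  assume "late_return f 0" "\<not> late_return f m"
  then obtain k where "first_return f k" "k \<le> m"
    by (auto simp: late_return_def not_less)
  then show "\<exists>k. 0 < k \<and> k \<le> m \<and> f k = f 0"
    by (auto simp: first_return_def)
qed

lemma late_return_mono: "late_return f m \<Longrightarrow> l \<le> m \<Longrightarrow> late_return f l"
  unfolding late_return_def by (meson le_less_trans)

text \<open>Links the vertex-based \<open>return_time\<close> to the path-based predicate. The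
  premise on \<open>S 0\<close> holds only almost surely under \<open>P z\<close>.\<close>

lemma late_return_iff_return_time:
  assumes z: "S 0 \<omega> = z"
  shows "enat m < return_time S z \<omega> \<and> return_time S z \<omega> < \<infinity> \<longleftrightarrow> late_return (\<lambda>i. S i \<omega>) m"
proof -
  have eq: "return_time S z \<omega> = enat k" if "first_return (\<lambda>i. S i \<omega>) k" for k
    unfolding return_time_def
  proof (rule antisym)
    show "(INF n\<in>{n. 1 \<le> n \<and> S n \<omega> = z}. enat n) \<le> enat k"
      by (rule INF_lower) (use that z in \<open>auto simp: first_return_def\<close>)
    show "enat k \<le> (INF n\<in>{n. 1 \<le> n \<and> S n \<omega> = z}. enat n)"
      by (rule INF_greatest) (use that z in \<open>force simp: first_return_def not_less[symmetric]\<close>)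
  qed
  show ?thesis
  proof safe
    assume m: "enat m < return_time S z \<omega>" and fin: "return_time S z \<omega> < \<infinity>"
    have "{n. 1 \<le> n \<and> S n \<omega> = z} \<noteq> {}"
    proof
      assume "{n. 1 \<le> n \<and> S n \<omega> = z} = {}"
      then have "return_time S z \<omega> = \<infinity>"
        unfolding return_time_def by (metis image_empty Inf_empty top_enat_def)
      with fin show False by simp
    qed
    then obtain n where "0 < n" "S n \<omega> = S 0 \<omega>"
      using z by (auto simp: Suc_le_eq)
    then obtain k where k: "first_return (\<lambda>i. S i \<omega>) k"
      using first_return_exists[of n "\<lambda>i. S i \<omega>"] by metis
    with eq m show "late_return (\<lambda>i. S i \<omega>) m"
      by (auto simp: late_return_def)
  next
    assume "late_return (\<lambda>i. S i \<omega>) m"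
    then obtain k where "m < k" "return_time S z \<omega> = enat k"
      using eq by (auto simp: late_return_def)
    then show "enat m < return_time S z \<omega>" "return_time S z \<omega> < \<infinity>"
      by simp_all
  qed
qed

text \<open>Every value is attained for a last time before \<open>n\<close>, and distinct last
  visits have distinct values, so \<open>f\<close> maps the last visits bijectively onto its
  image.\<close>

lemma card_image_eq_card_last_visits:
  fixes f :: "nat \<Rightarrow> 'a"
  shows "card (f ` {..<n}) = card {i. i < n \<and> (\<forall>j. i < j \<and> j < n \<longrightarrow> f j \<noteq> f i)}"
proof -
  let ?L = "{i. i < n \<and> (\<forall>j. i < j \<and> j < n \<longrightarrow> f j \<noteq> f i)}"
  have "f ` {..<n} \<subseteq> f ` ?L"
  proof
    fix y assume "y \<in> f ` {..<n}"
    then obtain i where i: "i < n" "f i = y" by auto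
    define l where "l = Max {i. i < n \<and> f i = y}"
    have l: "l \<in> {i. i < n \<and> f i = y}"
      unfolding l_def by (rule Max_in) (use i in auto)
    have "j \<le> l" if "j < n" "f j = y" for j
      unfolding l_def by (rule Max_ge) (use that in auto)
    then have "l \<in> ?L"
      using l by force
    with l show "y \<in> f ` ?L"
      by auto
  qed
  moreover have "inj_on f ?L"
    by (auto simp: inj_on_def) (metis (no_types) linorder_neqE_nat)
  ultimately have "bij_betw f ?L (f ` {..<n})"
    unfolding bij_betw_def by blast
  then show ?thesis
    by (rule bij_betw_same_card[symmetric])
qed

text \<open>After index \<open>i\<close> there remain \<open>n - Suc i\<close> steps before time
  \<open>n\<close>. No return in them means no return at all or a late one; these cases are
  disjoint, with indicators \<open>1 - Y i\<close> and \<open>H i (n - 1 - i)\<close>.\<close>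

lemma walk_range_eq_sum:
  "real (walk_range S n \<omega>) = (\<Sum>i<n. 1 - of_bool (late_return (\<lambda>k. S (i + k) \<omega>) 0)
     + of_bool (late_return (\<lambda>k. S (i + k) \<omega>) (n - Suc i)))"
proof -
  have last: "(\<forall>j. i < j \<and> j < n \<longrightarrow> S j \<omega> \<noteq> S i \<omega>) \<longleftrightarrow>
    \<not> (\<exists>k. 0 < k \<and> k \<le> n - Suc i \<and> S (i + k) \<omega> = S (i + 0) \<omega>)" (is "?l \<longleftrightarrow> ?r") if "i < n" for i
  proof
    assume ?l then show ?r using that by auto
  next
    assume r: ?r
    show ?l
    proof (intro allI impI)
      fix j assume "i < j \<and> j < n"
      then have "0 < j - i" "j - i \<le> n - Suc i" "i + (j - i) = j" by auto
      with r show "S j \<omega> \<noteq> S i \<omega>" by (metis add_0_right)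
    qed
  qed
  have "real (walk_range S n \<omega>) =
      (\<Sum>i<n. of_bool (\<forall>j. i < j \<and> j < n \<longrightarrow> S j \<omega> \<noteq> S i \<omega>))"
    unfolding walk_range_def card_image_eq_card_last_visits
    by (simp add: Int_def)
  also have "\<dots> = (\<Sum>i<n. 1 - of_bool (late_return (\<lambda>k. S (i + k) \<omega>) 0)
     + of_bool (late_return (\<lambda>k. S (i + k) \<omega>) (n - Suc i)))"
  proof (rule sum.cong)
    fix i assume "i \<in> {..<n}"
    then have "i < n" by simp
    show "of_bool (\<forall>j. i < j \<and> j < n \<longrightarrow> S j \<omega> \<noteq> S i \<omega>) =
      1 - of_bool (late_return (\<lambda>k. S (i + k) \<omega>) 0)
        + (of_bool (late_return (\<lambda>k. S (i + k) \<omega>) (n - Suc i)) :: real)"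
      unfolding last[OF \<open>i < n\<close>] return_within_iff[of "n - Suc i" "\<lambda>k. S (i + k) \<omega>"]
      using late_return_mono[of "\<lambda>k. S (i + k) \<omega>" "n - Suc i" 0]
      by (auto simp: of_bool_def)
  qed simp
  finally show ?thesis .
qed

section \<open>Countability of the state space and measurability of return events\<close>

text \<open>Connectedness makes \<open>X\<close> the set reachable from one vertex, and finite
  neighbourhoods keep each step of the closure countable.\<close>

lemma (in weighted_graph) countable_vertices: "countable X"
proof -
  let ?R = "{(u, v). u \<in> X \<and> v \<in> X \<and> E u v}"
  obtain x where x: "x \<in> X"
    using infinite_imp_nonempty[OF infinite_vertices] by blast
  have "countable (?R\<^sup>* `` {x})"
  proof (rule countable_rtrancl)
    fix Y :: "'a set" assume Y: "countable Y"
    have "?R `` Y \<subseteq> (\<Union>y\<in>Y \<inter> X. neighbours X E y)"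
      by (auto simp: neighbours_def)
    moreover have "countable \<dots>"
      using Y locally_finite by (intro countable_UN) (auto intro: countable_finite)
    ultimately show "countable (?R `` Y)"
      by (rule countable_subset)
  qed simp
  moreover have "X \<subseteq> ?R\<^sup>* `` {x}"
    using connected_graph x by blast
  ultimately show ?thesis
    by (rule countable_subset[rotated])
qed

locale countable_random_walk = random_walk X \<mu> P S
  for X :: "'a set" and \<mu> and P :: "'a \<Rightarrow> 'w measure" and S +
  assumes countable_X: "countable X"
begin

lemma measurable_S_eq_const [measurable]:
  assumes "x \<in> X"
  shows "Measurable.pred (P x) (\<lambda>\<omega>. S i \<omega> = y)"
proof (cases "y \<in> X")
  case True
  have "S i -` {y} \<inter> space (P x) \<in> sets (P x)"
    using measurable_S[OF assms] True by (intro measurable_sets) auto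
  moreover have "S i -` {y} \<inter> space (P x) = {\<omega> \<in> space (P x). S i \<omega> = y}" by auto
  ultimately show ?thesis by (simp add: pred_def)
next
  case False
  have "S i \<omega> \<noteq> y" if "\<omega> \<in> space (P x)" for \<omega>
    using measurable_space[OF measurable_S[OF assms] that] False by auto
  then have "{\<omega> \<in> space (P x). S i \<omega> = y} = {}" by auto
  then show ?thesis unfolding pred_def by (simp only: sets.empty_sets)
qed

lemma S_in_X: "x \<in> X \<Longrightarrow> \<omega> \<in> space (P x) \<Longrightarrow> S i \<omega> \<in> X"
  using measurable_space[OF measurable_S] by auto

lemma measurable_S_eq_S:
  assumes "x \<in> X"
  shows "Measurable.pred (P x) (\<lambda>\<omega>. S i \<omega> = S j \<omega>)"
proof -
  have "{\<omega> \<in> space (P x). S i \<omega> = S j \<omega>} =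
      (\<Union>y\<in>X. {\<omega> \<in> space (P x). S i \<omega> = y \<and> S j \<omega> = y})"
    using S_in_X[OF assms] by auto
  also have "\<dots> \<in> sets (P x)"
    using assms countable_X
    by (intro sets.countable_UN'') measurable
  finally show ?thesis by (simp add: pred_def)
qed

lemma measurable_first_return [measurable]:
  assumes "x \<in> X"
  shows "Measurable.pred (P x) (\<lambda>\<omega>. first_return (\<lambda>k. S (i + k) \<omega>) k)"
  unfolding first_return_def
  by (intro pred_intros_logic pred_intros_countable measurable_S_eq_S assms measurable_const) simp_all

lemma measurable_late_return [measurable]:
  assumes "x \<in> X"
  shows "Measurable.pred (P x) (\<lambda>\<omega>. late_return (\<lambda>k. S (i + k) \<omega>) m)"
  unfolding late_return_def
  by (intro pred_intros_logic pred_intros_countable measurable_first_return assms measurable_const) simp_all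

lemma measurable_late_return_0 [measurable]:
  "x \<in> X \<Longrightarrow> Measurable.pred (P x) (\<lambda>\<omega>. late_return (\<lambda>k. S k \<omega>) m)"
  using measurable_late_return[of x 0 m] by simp

section \<open>Path probabilities and the Markov property\<close>

text \<open>The chain hypothesis speaks of pasts with positive probability. For a null past both
  sides are 0, so the product formula holds for every past.\<close>

lemma prob_path_Suc:
  assumes x: "x \<in> X" and s: "\<And>i. i \<le> Suc n \<Longrightarrow> s i \<in> X"
  shows "\<P>(\<omega> in P x. \<forall>i\<le>Suc n. S i \<omega> = s i) =
    \<P>(\<omega> in P x. \<forall>i\<le>n. S i \<omega> = s i) * (\<mu> (s n) (s (Suc n)) / vertex_weight X \<mu> (s n))"
proof -
  interpret prob_space "P x" using x by (rule prob_space_P)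
  have eq: "(\<forall>i\<le>Suc n. S i \<omega> = s i) \<longleftrightarrow> S (Suc n) \<omega> = s (Suc n) \<and> (\<forall>i\<le>n. S i \<omega> = s i)" for \<omega>
    by (auto simp: le_Suc_eq)
  have le: "\<P>(\<omega> in P x. \<forall>i\<le>Suc n. S i \<omega> = s i) \<le> \<P>(\<omega> in P x. \<forall>i\<le>n. S i \<omega> = s i)"
    using x by (intro finite_measure_mono) auto
  show ?thesis
  proof (cases "\<P>(\<omega> in P x. \<forall>i\<le>n. S i \<omega> = s i) > 0")
    case True
    then show ?thesis
      using markov[of x n s "s (Suc n)"] x s by (simp add: cond_prob_def eq field_simps)
  next
    case False
    then have 0: "\<P>(\<omega> in P x. \<forall>i\<le>n. S i \<omega> = s i) = 0"
      by (simp add: zero_less_measure_iff)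
    with le have "\<P>(\<omega> in P x. \<forall>i\<le>Suc n. S i \<omega> = s i) = 0"
      by (simp add: measure_le_0_iff)
    with 0 show ?thesis by simp
  qed
qed

text \<open>Both sides gain the same transition factor with each further step. This compares the
  future with a fresh walk on the other space \<open>P (s n)\<close>.\<close>

lemma prob_path_append:
  assumes x: "x \<in> X" and s: "\<And>i. i \<le> n + k \<Longrightarrow> s i \<in> X"
  shows "\<P>(\<omega> in P x. \<forall>i\<le>n + k. S i \<omega> = s i) =
    \<P>(\<omega> in P x. \<forall>i\<le>n. S i \<omega> = s i) * \<P>(\<omega> in P (s n). \<forall>i\<le>k. S i \<omega> = s (n + i))"
  using s
proof (induction k)
  case 0
  then show ?case using start[of "s n"] by simp
next
  case (Suc k)
  have "\<P>(\<omega> in P x. \<forall>i\<le>Suc (n + k). S i \<omega> = s i) =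
      \<P>(\<omega> in P x. \<forall>i\<le>n + k. S i \<omega> = s i)
        * (\<mu> (s (n + k)) (s (Suc (n + k))) / vertex_weight X \<mu> (s (n + k)))"
    using Suc.prems by (intro prob_path_Suc x) auto
  moreover have "\<P>(\<omega> in P (s n). \<forall>i\<le>Suc k. S i \<omega> = s (n + i)) =
      \<P>(\<omega> in P (s n). \<forall>i\<le>k. S i \<omega> = s (n + i))
        * (\<mu> (s (n + k)) (s (Suc (n + k))) / vertex_weight X \<mu> (s (n + k)))"
    using prob_path_Suc[of "s n" k "\<lambda>i. s (n + i)"] Suc.prems by simp
  ultimately show ?case
    using Suc by simp
qed

text \<open>The Markov property for an event \<open>Q\<close> decided by the coordinates up to
  \<open>k\<close>: both sides are sums over the countably many continuations, matched term by term.
  The condition \<open>S 0 \<omega> = s n\<close> appears because the walk under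
  \<open>P (s n)\<close> starts there only almost surely.\<close>

lemma emeasure_path_future:
  assumes x: "x \<in> X" and s: "\<And>i. i \<le> n \<Longrightarrow> s i \<in> X"
    and Q: "\<And>f g. (\<And>i. i \<le> k \<Longrightarrow> f i = g i) \<Longrightarrow> Q f \<Longrightarrow> Q g"
  shows "emeasure (P x) {\<omega> \<in> space (P x). (\<forall>i\<le>n. S i \<omega> = s i) \<and> Q (\<lambda>i. S (n + i) \<omega>)} =
    emeasure (P x) {\<omega> \<in> space (P x). \<forall>i\<le>n. S i \<omega> = s i}
      * emeasure (P (s n)) {\<omega> \<in> space (P (s n)). S 0 \<omega> = s n \<and> Q (\<lambda>i. S i \<omega>)}"
proof -
  \<comment> \<open>Continuations are extensional functions on \<open>{..k}\<close>, hence
    determined by their values there; so there are countably many and their cylinders are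
    disjoint.\<close>
  define T where "T = {t \<in> Pi\<^sub>E {..k} (\<lambda>_. X). t 0 = s n \<and> Q t}"
  define A where "A t = {\<omega> \<in> space (P x). (\<forall>i\<le>n. S i \<omega> = s i) \<and> (\<forall>i\<le>k. S (n + i) \<omega> = t i)}" for t
  define B where "B t = {\<omega> \<in> space (P (s n)). \<forall>i\<le>k. S i \<omega> = t i}" for t
  have sn: "s n \<in> X" using s by simp
  have "countable T"
    unfolding T_def using countable_PiE[of "{..k}" "\<lambda>_. X"] countable_X by (simp add: countable_Collect)
  have eqT: "t = t'" if "t \<in> T" "t' \<in> T" "\<And>i. i \<le> k \<Longrightarrow> t i = t' i" for t t'
    using that by (intro PiE_ext[of t "{..k}" "\<lambda>_. X" t']) (auto simp: T_def)
  have restrict: "\<exists>t\<in>T. \<forall>i\<le>k. f i = t i" if "f 0 = s n" "Q f" "\<And>i. f i \<in> X" for f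
    using that Q[of f "restrict f {..k}"] by (intro bexI[of _ "restrict f {..k}"]) (auto simp: T_def)
  have QT: "Q f" if "t \<in> T" "\<And>i. i \<le> k \<Longrightarrow> f i = t i" for f t
    using that Q[of t f] by (auto simp: T_def)
  have "{\<omega> \<in> space (P x). (\<forall>i\<le>n. S i \<omega> = s i) \<and> Q (\<lambda>i. S (n + i) \<omega>)} = (\<Union>t\<in>T. A t)"
  proof (intro equalityI subsetI)
    fix \<omega> assume "\<omega> \<in> {\<omega> \<in> space (P x). (\<forall>i\<le>n. S i \<omega> = s i) \<and> Q (\<lambda>i. S (n + i) \<omega>)}"
    then show "\<omega> \<in> (\<Union>t\<in>T. A t)"
      using restrict[of "\<lambda>i. S (n + i) \<omega>"] S_in_X[OF x, of \<omega>] by (auto simp: A_def)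
  next
    fix \<omega> assume "\<omega> \<in> (\<Union>t\<in>T. A t)"
    then show "\<omega> \<in> {\<omega> \<in> space (P x). (\<forall>i\<le>n. S i \<omega> = s i) \<and> Q (\<lambda>i. S (n + i) \<omega>)}"
      using QT[where f = "\<lambda>i. S (n + i) \<omega>"] by (auto simp: A_def)
  qed
  then have "emeasure (P x) {\<omega> \<in> space (P x). (\<forall>i\<le>n. S i \<omega> = s i) \<and> Q (\<lambda>i. S (n + i) \<omega>)} =
      emeasure (P x) (\<Union>t\<in>T. A t)"
    by simp
  also have "\<dots> = (\<integral>\<^sup>+t. emeasure (P x) (A t) \<partial>count_space T)"
  proof (rule emeasure_UN_countable)
    show "A t \<in> sets (P x)" for t
      unfolding A_def using x by measurable
    show "disjoint_family_on A T"
      unfolding disjoint_family_on_def A_def using eqT by fastforce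
  qed fact
  also have "\<dots> = (\<integral>\<^sup>+t. emeasure (P x) {\<omega> \<in> space (P x). \<forall>i\<le>n. S i \<omega> = s i} * emeasure (P (s n)) (B t) \<partial>count_space T)"
  proof (rule nn_integral_cong)
    fix t assume "t \<in> space (count_space T)"
    then have t: "t \<in> T" by simp
    \<comment> \<open>\<open>u\<close> glues past and continuation; they overlap at index
      \<open>n\<close>, where \<open>t 0 = s n\<close>.\<close>
    define u where "u i = (if i \<le> n then s i else t (i - n))" for i
    have un: "u (n + i) = t i" if "i \<le> k" for i
      using t by (auto simp: u_def T_def)
    have uX: "u i \<in> X" if "i \<le> n + k" for i
      using t s that by (auto simp: u_def T_def PiE_def Pi_def)
    have split: "(\<forall>i\<le>n + k. S i \<omega> = u i) \<longleftrightarrow> (\<forall>i\<le>n. S i \<omega> = s i) \<and> (\<forall>i\<le>k. S (n + i) \<omega> = t i)" for \<omega>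
    proof (intro iffI conjI allI impI)
      fix i assume "\<forall>i\<le>n + k. S i \<omega> = u i" "i \<le> n"
      then show "S i \<omega> = s i" by (auto simp: u_def dest: spec[of _ i])
    next
      fix i assume "\<forall>i\<le>n + k. S i \<omega> = u i" "i \<le> k"
      then show "S (n + i) \<omega> = t i" using un by simp
    next
      fix i assume *: "(\<forall>i\<le>n. S i \<omega> = s i) \<and> (\<forall>i\<le>k. S (n + i) \<omega> = t i)" and i: "i \<le> n + k"
      show "S i \<omega> = u i"
      proof (cases "i \<le> n")
        case False
        then show ?thesis using * i by (auto simp: u_def dest: spec[of _ "i - n"])
      qed (use * in \<open>auto simp: u_def\<close>)
    qed
    interpret Px: prob_space "P x" using x by (rule prob_space_P)
    interpret Pn: prob_space "P (s n)" using sn by (rule prob_space_P)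
    have "u n = s n" by (simp add: u_def)
    moreover have "(\<forall>i\<le>n. S i \<omega> = u i) \<longleftrightarrow> (\<forall>i\<le>n. S i \<omega> = s i)" for \<omega>
      by (auto simp: u_def)
    moreover have "(\<forall>i\<le>k. S i \<omega> = u (n + i)) \<longleftrightarrow> (\<forall>i\<le>k. S i \<omega> = t i)" for \<omega>
      using un by auto
    ultimately have "measure (P x) (A t) = \<P>(\<omega> in P x. \<forall>i\<le>n. S i \<omega> = s i) * measure (P (s n)) (B t)"
      using prob_path_append[of x n k u, OF x uX] unfolding split A_def B_def by simp
    then show "emeasure (P x) (A t) = emeasure (P x) {\<omega> \<in> space (P x). \<forall>i\<le>n. S i \<omega> = s i} * emeasure (P (s n)) (B t)"
      by (simp add: Px.emeasure_eq_measure Pn.emeasure_eq_measure ennreal_mult)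
  qed
  also have "\<dots> = emeasure (P x) {\<omega> \<in> space (P x). \<forall>i\<le>n. S i \<omega> = s i} * (\<integral>\<^sup>+t. emeasure (P (s n)) (B t) \<partial>count_space T)"
    by (rule nn_integral_cmult) simp
  also have "(\<integral>\<^sup>+t. emeasure (P (s n)) (B t) \<partial>count_space T) = emeasure (P (s n)) (\<Union>t\<in>T. B t)"
  proof (rule emeasure_UN_countable[symmetric])
    show "B t \<in> sets (P (s n))" for t
      unfolding B_def using sn by measurable
    show "disjoint_family_on B T"
      unfolding disjoint_family_on_def B_def using eqT by fastforce
  qed fact
  also have "(\<Union>t\<in>T. B t) = {\<omega> \<in> space (P (s n)). S 0 \<omega> = s n \<and> Q (\<lambda>i. S i \<omega>)}"
  proof (intro equalityI subsetI)
    fix \<omega> assume "\<omega> \<in> {\<omega> \<in> space (P (s n)). S 0 \<omega> = s n \<and> Q (\<lambda>i. S i \<omega>)}"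
    then show "\<omega> \<in> (\<Union>t\<in>T. B t)"
      using restrict[of "\<lambda>i. S i \<omega>"] S_in_X[OF sn, of \<omega>] by (auto simp: B_def)
  next
    fix \<omega> assume "\<omega> \<in> (\<Union>t\<in>T. B t)"
    then show "\<omega> \<in> {\<omega> \<in> space (P (s n)). S 0 \<omega> = s n \<and> Q (\<lambda>i. S i \<omega>)}"
      using QT[where f = "\<lambda>i. S i \<omega>"] by (auto simp: B_def T_def)
  qed
  finally show ?thesis .
qed

lemma AE_start: "x \<in> X \<Longrightarrow> AE \<omega> in P x. S 0 \<omega> = x"
  using start prob_space.AE_prob_1[OF prob_space_P, of x "{\<omega> \<in> space (P x). S 0 \<omega> = x}"] by auto

text \<open>At \<open>m = 0\<close> this is the return probability \<open>p z\<close>.\<close>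

definition late_return_prob :: "nat \<Rightarrow> 'a \<Rightarrow> real" where
  "late_return_prob m z = \<P>(\<omega> in P z. late_return (\<lambda>k. S k \<omega>) m)"

text \<open>The two events agree wherever \<open>S 0 = z\<close>, that is, almost surely.
  Measurability of the right-hand event is shown separately, because the spaces may be
  incomplete.\<close>

lemma late_return_prob_eq:
  assumes "z \<in> X"
  shows "late_return_prob m z = \<P>(\<omega> in P z. enat m < return_time S z \<omega> \<and> return_time S z \<omega> < \<infinity>)"
proof -
  have ae: "AE \<omega> in P z. late_return (\<lambda>k. S k \<omega>) m \<longleftrightarrow>
      enat m < return_time S z \<omega> \<and> return_time S z \<omega> < \<infinity>"
    using AE_start[OF assms] by eventually_elim (rule late_return_iff_return_time[symmetric])
  have meas: "Measurable.pred (P z) (\<lambda>\<omega>. enat m < return_time S z \<omega> \<and> return_time S z \<omega> < \<infinity>)"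
  proof -
    have "enat m < return_time S z \<omega> \<and> return_time S z \<omega> < \<infinity> \<longleftrightarrow>
        (\<exists>k>m. 0 < k \<and> S k \<omega> = z \<and> (\<forall>l. 0 < l \<and> l < k \<longrightarrow> S l \<omega> \<noteq> z))" for \<omega>
    proof -
      \<comment> \<open>\<open>return_time\<close> ignores time 0, so \<open>S 0\<close> may be
        overwritten by \<open>z\<close>; this gives a description by countably many coordinates that
        is valid at every point.\<close>
      have "return_time S z \<omega> = return_time (S(0 := \<lambda>_. z)) z \<omega>"
        unfolding return_time_def by (rule arg_cong[where f = "\<lambda>A. INF n\<in>A. enat n"]) auto
      then show ?thesis
        using late_return_iff_return_time[of "S(0 := \<lambda>_. z)" \<omega> z m]
        by (auto simp: late_return_def first_return_def)
    qed
    then show ?thesis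
      using assms by simp
  qed
  show ?thesis
    unfolding late_return_prob_def
    by (intro measure_eq_AE) (use ae meas assms in auto)
qed

lemma late_return_prob_bounds: 
  assumes "z \<in> X" shows "0 \<le> late_return_prob m z" "late_return_prob m z \<le> 1"
  using prob_space.prob_le_1[OF prob_space_P[OF assms]] by (auto simp: late_return_prob_def)

text \<open>A late return involves the whole future, so \<open>emeasure_path_future\<close> does not
  apply directly. Splitting by the exact first return time \<open>k > m\<close> gives disjoint local
  events, over which the identity is summed.\<close>

lemma prob_path_late_return:
  assumes x: "x \<in> X" and s: "\<And>i. i \<le> n \<Longrightarrow> s i \<in> X"
  shows "\<P>(\<omega> in P x. (\<forall>i\<le>n. S i \<omega> = s i) \<and> late_return (\<lambda>k. S (n + k) \<omega>) m) =
    \<P>(\<omega> in P x. \<forall>i\<le>n. S i \<omega> = s i) * late_return_prob m (s n)"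
proof -
  define C where "C = emeasure (P x) {\<omega> \<in> space (P x). \<forall>i\<le>n. S i \<omega> = s i}"
  define A where "A k = {\<omega> \<in> space (P x). (\<forall>i\<le>n. S i \<omega> = s i) \<and> first_return (\<lambda>k. S (n + k) \<omega>) k}" for k
  define B where "B k = {\<omega> \<in> space (P (s n)). S 0 \<omega> = s n \<and> first_return (\<lambda>k. S k \<omega>) k}" for k
  have sn: "s n \<in> X" using s by simp
  interpret Px: prob_space "P x" using x by (rule prob_space_P)
  interpret Pn: prob_space "P (s n)" using sn by (rule prob_space_P)
  have [measurable]: "Measurable.pred (P (s n)) (\<lambda>\<omega>. first_return (\<lambda>k. S k \<omega>) k)" for k
    using measurable_first_return[OF sn, of 0] by simp
  have "emeasure (P x) (\<Union>k\<in>{m<..}. A k) = (\<integral>\<^sup>+k. emeasure (P x) (A k) \<partial>count_space {m<..})"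
  proof (rule emeasure_UN_countable)
    show "A k \<in> sets (P x)" for k
      unfolding A_def using x by measurable
    show "disjoint_family_on A {m<..}"
      by (auto simp: disjoint_family_on_def A_def dest: first_return_unique)
  qed simp
  also have "\<dots> = (\<integral>\<^sup>+k. C * emeasure (P (s n)) (B k) \<partial>count_space {m<..})"
    unfolding A_def B_def C_def
  proof (intro nn_integral_cong emeasure_path_future x s)
    fix k and f g :: "nat \<Rightarrow> 'a"
    assume "\<And>i. i \<le> k \<Longrightarrow> f i = g i" "first_return f k"
    then show "first_return g k"
      using first_return_cong[of k f g] by blast
  qed
  also have "\<dots> = C * (\<integral>\<^sup>+k. emeasure (P (s n)) (B k) \<partial>count_space {m<..})"
    by (rule nn_integral_cmult) simp
  also have "(\<integral>\<^sup>+k. emeasure (P (s n)) (B k) \<partial>count_space {m<..}) = emeasure (P (s n)) (\<Union>k\<in>{m<..}. B k)"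
  proof (rule emeasure_UN_countable[symmetric])
    show "B k \<in> sets (P (s n))" for k
      unfolding B_def using sn by measurable
    show "disjoint_family_on B {m<..}"
      by (auto simp: disjoint_family_on_def B_def dest: first_return_unique)
  qed simp
  also have "(\<Union>k\<in>{m<..}. B k) = {\<omega> \<in> space (P (s n)). S 0 \<omega> = s n \<and> late_return (\<lambda>k. S k \<omega>) m}"
    by (auto simp: B_def late_return_def)
  also have "emeasure (P (s n)) \<dots> = emeasure (P (s n)) {\<omega> \<in> space (P (s n)). late_return (\<lambda>k. S k \<omega>) m}"
    by (rule emeasure_eq_AE) (use AE_start[OF sn] sn in auto)
  also have "(\<Union>k\<in>{m<..}. A k) = {\<omega> \<in> space (P x). (\<forall>i\<le>n. S i \<omega> = s i) \<and> late_return (\<lambda>k. S (n + k) \<omega>) m}"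
    by (auto simp: A_def late_return_def)
  finally show ?thesis
    by (simp add: C_def late_return_prob_def Px.emeasure_eq_measure Pn.emeasure_eq_measure
        ennreal_mult[symmetric])
qed

section \<open>Conditional means and covariances of the return indicators\<close>

definition late :: "nat \<Rightarrow> nat \<Rightarrow> 'w \<Rightarrow> real" where
  "late i m \<omega> = of_bool (late_return (\<lambda>k. S (i + k) \<omega>) m)"

lemma late_bounds: "0 \<le> late i m \<omega>" "late i m \<omega> \<le> 1"
  by (auto simp: late_def)

lemma measurable_late [measurable]: "x \<in> X \<Longrightarrow> late i m \<in> borel_measurable (P x)"
  unfolding late_def of_bool_def by measurable

lemma measurable_late_return_prob [measurable]:
  assumes "x \<in> X"
  shows "(\<lambda>\<omega>. late_return_prob m (S i \<omega>)) \<in> borel_measurable (P x)"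
  by (rule measurable_compose[OF measurable_S[OF assms]]) simp

lemma integrable_bounded:
  fixes f :: "'w \<Rightarrow> real"
  assumes "x \<in> X" "f \<in> borel_measurable (P x)" "\<And>\<omega>. \<omega> \<in> space (P x) \<Longrightarrow> \<bar>f \<omega>\<bar> \<le> c"
  shows "integrable (P x) f"
proof -
  interpret prob_space "P x" using assms(1) by (rule prob_space_P)
  show ?thesis
    by (rule integrable_const_bound[of _ c]) (use assms in auto)
qed

text \<open>The Markov property in the form that \<open>late n m\<close> has conditional expectation
  \<open>late_return_prob m (S n)\<close> given the path up to time \<open>n\<close>.\<close>

lemma integral_past_times_centered_late:
  assumes x: "x \<in> X" and meas: "h \<in> borel_measurable (P x)"
    and bound: "\<And>\<omega>. \<omega> \<in> space (P x) \<Longrightarrow> \<bar>h \<omega>\<bar> \<le> c"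
    and past: "\<And>\<omega> \<omega>'. \<lbrakk>\<omega> \<in> space (P x); \<omega>' \<in> space (P x); \<And>i. i \<le> n \<Longrightarrow> S i \<omega> = S i \<omega>'\<rbrakk>
      \<Longrightarrow> h \<omega> = h \<omega>'"
  shows "(\<integral>\<omega>. h \<omega> * (late n m \<omega> - late_return_prob m (S n \<omega>)) \<partial>P x) = 0"
proof -
  interpret prob_space "P x" using x by (rule prob_space_P)
  define T where "T = Pi\<^sub>E {..n} (\<lambda>_. X)"
  define A where "A t = {\<omega> \<in> space (P x). \<forall>i\<le>n. S i \<omega> = t i}" for t
  define f where "f \<omega> = h \<omega> * (late n m \<omega> - late_return_prob m (S n \<omega>))" for \<omega>
  have [measurable]: "h \<in> borel_measurable (P x)" by (rule meas)
  have p: "0 \<le> late_return_prob m (S i \<omega>) \<and> late_return_prob m (S i \<omega>) \<le> 1" if "\<omega> \<in> space (P x)" for i \<omega>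
    using late_return_prob_bounds S_in_X[OF x that] by blast
  have f: "integrable (P x) f"
  proof (rule integrable_bounded[OF x])
    show "f \<in> borel_measurable (P x)"
      unfolding f_def using x by measurable
    fix \<omega> assume \<omega>: "\<omega> \<in> space (P x)"
    have "\<bar>late n m \<omega> - late_return_prob m (S n \<omega>)\<bar> \<le> 1"
      using p[OF \<omega>, of n] late_bounds[of n m \<omega>] by linarith
    then show "\<bar>f \<omega>\<bar> \<le> c * 1"
      unfolding f_def abs_mult using bound[OF \<omega>] by (intro mult_mono) auto
  qed
  have sets: "A t \<in> sets (P x)" for t
    unfolding A_def using x by measurable
  have "(\<integral>\<omega>. f \<omega> \<partial>P x) = 0"
  proof (rule integral_eq_0_if_countable_partition[OF f])
    show "countable T"
      unfolding T_def using countable_X by (intro countable_PiE) auto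
    show "disjoint_family_on A T"
      unfolding disjoint_family_on_def
    proof (intro ballI impI)
      fix t t' assume t: "t \<in> T" "t' \<in> T" "t \<noteq> t'"
      then obtain i where "i \<le> n" "t i \<noteq> t' i"
        using PiE_ext[of t "{..n}" "\<lambda>_. X" t'] by (auto simp: T_def)
      then show "A t \<inter> A t' = {}"
        by (auto simp: A_def)
    qed
    show "space (P x) = (\<Union>t\<in>T. A t)"
    proof (intro equalityI subsetI)
      fix \<omega> assume \<omega>: "\<omega> \<in> space (P x)"
      then have "restrict (\<lambda>i. S i \<omega>) {..n} \<in> T" "\<omega> \<in> A (restrict (\<lambda>i. S i \<omega>) {..n})"
        using S_in_X[OF x] by (auto simp: T_def A_def)
      then show "\<omega> \<in> (\<Union>t\<in>T. A t)" by blast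
    qed (auto simp: A_def)
  next
    fix t assume t: "t \<in> T"
    show "(\<integral>\<omega>. indicator (A t) \<omega> * f \<omega> \<partial>P x) = 0"
    proof (cases "A t = {}")
      case False
      \<comment> \<open>By \<open>past\<close>, \<open>h\<close> is constant on the cell, so its
        value at one sample point factors out of the integral.\<close>
      then obtain \<omega>0 where \<omega>0: "\<omega>0 \<in> A t" by auto
      define B where "B = {\<omega> \<in> space (P x). (\<forall>i\<le>n. S i \<omega> = t i) \<and> late_return (\<lambda>k. S (n + k) \<omega>) m}"
      have B: "B \<in> sets (P x)"
        unfolding B_def using x by measurable
      have "indicator (A t) \<omega> * f \<omega> =
          h \<omega>0 * (indicator B \<omega> - late_return_prob m (t n) * indicator (A t) \<omega>)" if "\<omega> \<in> space (P x)" for \<omega>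
      proof (cases "\<omega> \<in> A t")
        case True
        have "h \<omega> = h \<omega>0"
          by (rule past) (use True \<omega>0 in \<open>auto simp: A_def\<close>)
        then show ?thesis
          using True by (auto simp: f_def A_def B_def late_def)
      qed (auto simp: A_def B_def)
      then have "(\<integral>\<omega>. indicator (A t) \<omega> * f \<omega> \<partial>P x) =
          (\<integral>\<omega>. h \<omega>0 * (indicator B \<omega> - late_return_prob m (t n) * indicator (A t) \<omega>) \<partial>P x)"
        by (intro Bochner_Integration.integral_cong) auto
      also have "\<dots> = h \<omega>0 * (prob B - late_return_prob m (t n) * prob (A t))"
        using B sets[of t]
        by (simp add: integrable_real_indicator less_top[symmetric] Bochner_Integration.integral_diff)
      also have "prob B = prob (A t) * late_return_prob m (t n)"
        unfolding B_def A_def using t by (intro prob_path_late_return x) (auto simp: T_def)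
      finally show ?thesis by simp
    qed simp
  qed (rule sets)
  then show ?thesis
    by (simp add: f_def)
qed

text \<open>Taking \<open>h = 1\<close> in the Markov property shows that the mean is that of
  \<open>late_return_prob m (S i)\<close>, which is bounded pointwise.\<close>

lemma expectation_late_le:
  assumes x: "x \<in> X" and \<epsilon>: "\<And>z. z \<in> X \<Longrightarrow> late_return_prob m z \<le> \<epsilon>"
  shows "(\<integral>\<omega>. late i m \<omega> \<partial>P x) \<le> \<epsilon>"
proof -
  interpret prob_space "P x" using x by (rule prob_space_P)
  have p: "0 \<le> late_return_prob m (S i \<omega>) \<and> late_return_prob m (S i \<omega>) \<le> 1" if "\<omega> \<in> space (P x)" for \<omega>
    using late_return_prob_bounds S_in_X[OF x that] by blast
  have i1: "integrable (P x) (late i m)"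
    by (rule integrable_bounded[OF x, of _ 1]) (use x late_bounds in auto)
  have i2: "integrable (P x) (\<lambda>\<omega>. late_return_prob m (S i \<omega>))"
    by (rule integrable_bounded[OF x, of _ 1]) (use x p in auto)
  have "(\<integral>\<omega>. 1 * (late i m \<omega> - late_return_prob m (S i \<omega>)) \<partial>P x) = 0"
    by (rule integral_past_times_centered_late[OF x, of _ 1]) auto
  then have "(\<integral>\<omega>. late i m \<omega> \<partial>P x) = (\<integral>\<omega>. late_return_prob m (S i \<omega>) \<partial>P x)"
    using i1 i2 by simp
  also have "\<dots> \<le> \<epsilon>"
    by (rule integral_le_const[OF i2]) (use \<epsilon> S_in_X[OF x] in auto)
  finally show ?thesis .
qed

text \<open>The sign is that of \<open>1 - Y i\<close> minus its conditional mean
  \<open>1 - p (S i)\<close>, as in the range formula. These are not martingale differences of the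
  walk, since \<open>late i 0\<close> looks at the whole future.\<close>

definition centered :: "nat \<Rightarrow> 'w \<Rightarrow> real" where
  "centered i \<omega> = late_return_prob 0 (S i \<omega>) - late i 0 \<omega>"

lemma measurable_centered [measurable]: "x \<in> X \<Longrightarrow> centered i \<in> borel_measurable (P x)"
  unfolding centered_def by measurable

lemma abs_centered_le:
  assumes "x \<in> X" "\<omega> \<in> space (P x)"
  shows "\<bar>centered i \<omega>\<bar> \<le> 1"
  using late_return_prob_bounds[OF S_in_X[OF assms], of 0 i] late_bounds[of i 0 \<omega>]
  by (auto simp: centered_def)

lemma abs_sum_centered_le:
  assumes "x \<in> X" "\<omega> \<in> space (P x)"
  shows "\<bar>\<Sum>i<n. centered i \<omega>\<bar> \<le> real n"
proof -
  have "\<bar>\<Sum>i<n. centered i \<omega>\<bar> \<le> (\<Sum>i<n. \<bar>centered i \<omega>\<bar>)"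
    by (rule sum_abs)
  also have "\<dots> \<le> (\<Sum>i<n. 1)"
    by (intro sum_mono abs_centered_le[OF assms])
  finally show ?thesis by simp
qed

text \<open>Up to the event that the return after time \<open>i\<close> takes place after time \<open>j\<close>,
  \<open>centered i\<close> is determined by the path up to time \<open>j\<close>.\<close>

lemma expectation_centered_mult_le:
  assumes x: "x \<in> X" and \<epsilon>: "\<And>z. z \<in> X \<Longrightarrow> late_return_prob (j - i) z \<le> \<epsilon>" and "i < j"
  shows "(\<integral>\<omega>. centered i \<omega> * centered j \<omega> \<partial>P x) \<le> \<epsilon>"
proof -
  interpret prob_space "P x" using x by (rule prob_space_P)
  define m where "m = j - i"
  \<comment> \<open>\<open>G\<close> is the indicator of a return within \<open>m\<close> steps
    minus \<open>p (S i)\<close>; as \<open>i + m = j\<close>, the path up to time \<open>j\<close>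
    determines it.\<close>
  define G where "G \<omega> = - (centered i \<omega> + late i m \<omega>)" for \<omega>
  have meas [measurable]: "G \<in> borel_measurable (P x)"
    unfolding G_def using x by measurable
  have G_bound: "\<bar>G \<omega>\<bar> \<le> 2" if "\<omega> \<in> space (P x)" for \<omega>
    using abs_centered_le[OF x that, of i] late_bounds[of i m \<omega>] by (simp add: G_def)
  have G_eq: "G \<omega> = of_bool (\<exists>k. 0 < k \<and> k \<le> m \<and> S (i + k) \<omega> = S (i + 0) \<omega>) - late_return_prob 0 (S i \<omega>)" for \<omega>
    unfolding return_within_iff[of m "\<lambda>k. S (i + k) \<omega>"]
    using late_return_mono[of "\<lambda>k. S (i + k) \<omega>" m 0]
    by (auto simp: G_def centered_def late_def)
  have past: "G \<omega> = G \<omega>'" if "\<And>l. l \<le> j \<Longrightarrow> S l \<omega> = S l \<omega>'" for \<omega> \<omega>'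
  proof -
    have "S (i + k) \<omega> = S (i + k) \<omega>'" if "k \<le> m" for k
      using that \<open>i < j\<close> by (intro \<open>\<And>l. l \<le> j \<Longrightarrow> S l \<omega> = S l \<omega>'\<close>) (simp add: m_def)
    then have "(\<exists>k. 0 < k \<and> k \<le> m \<and> S (i + k) \<omega> = S (i + 0) \<omega>) \<longleftrightarrow>
        (\<exists>k. 0 < k \<and> k \<le> m \<and> S (i + k) \<omega>' = S (i + 0) \<omega>')" "S i \<omega> = S i \<omega>'"
      using \<open>i < j\<close> that[of i] by auto
    then show ?thesis
      unfolding G_eq by simp
  qed
  have G0: "(\<integral>\<omega>. G \<omega> * (late j 0 \<omega> - late_return_prob 0 (S j \<omega>)) \<partial>P x) = 0"
    by (rule integral_past_times_centered_late[OF x meas G_bound past])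
  \<comment> \<open>Since \<open>centered i = - G - late i m\<close>, the product is the first term
    on the right plus \<open>late i m * (- centered j)\<close>, and \<open>- centered j\<close> is
    at most 1.\<close>
  have le: "centered i \<omega> * centered j \<omega> \<le> G \<omega> * (late j 0 \<omega> - late_return_prob 0 (S j \<omega>)) + late i m \<omega>"
    if "\<omega> \<in> space (P x)" for \<omega>
  proof -
    have "late i m \<omega> * (- centered j \<omega>) \<le> late i m \<omega> * 1"
      using abs_centered_le[OF x that, of j] late_bounds by (intro mult_left_mono) auto
    then show ?thesis
      by (simp add: G_def centered_def algebra_simps)
  qed
  have i1: "integrable (P x) (\<lambda>\<omega>. centered i \<omega> * centered j \<omega>)"
  proof (rule integrable_bounded[OF x])
    show "\<bar>centered i \<omega> * centered j \<omega>\<bar> \<le> 1 * 1" if "\<omega> \<in> space (P x)" for \<omega>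
      unfolding abs_mult using abs_centered_le[OF x that] by (intro mult_mono) auto
  qed (use x in measurable)
  have i2: "integrable (P x) (\<lambda>\<omega>. G \<omega> * (late j 0 \<omega> - late_return_prob 0 (S j \<omega>)))"
  proof (rule integrable_bounded[OF x])
    show "\<bar>G \<omega> * (late j 0 \<omega> - late_return_prob 0 (S j \<omega>))\<bar> \<le> 2 * 1" if "\<omega> \<in> space (P x)" for \<omega>
      unfolding abs_mult using abs_centered_le[OF x that, of j] G_bound[OF that]
      by (intro mult_mono) (auto simp: centered_def)
  qed (use x in measurable)
  have i3: "integrable (P x) (late i m)"
    by (rule integrable_bounded[OF x, of _ 1]) (use x late_bounds in auto)
  have "(\<integral>\<omega>. centered i \<omega> * centered j \<omega> \<partial>P x) \<le>
      (\<integral>\<omega>. G \<omega> * (late j 0 \<omega> - late_return_prob 0 (S j \<omega>)) + late i m \<omega> \<partial>P x)"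
    by (intro integral_mono i1 i2 i3 Bochner_Integration.integrable_add le)
  also have "\<dots> = (\<integral>\<omega>. late i m \<omega> \<partial>P x)"
    using G0 i2 i3 by simp
  also have "\<dots> \<le> \<epsilon>"
    using \<epsilon> by (intro expectation_late_le x) (simp add: m_def)
  finally show ?thesis .
qed

section \<open>Linear second moment and the almost sure asymptotics of the range\<close>

context
  fixes \<epsilon> :: "nat \<Rightarrow> real" and K :: real
  assumes late_le: "\<And>z m. z \<in> X \<Longrightarrow> late_return_prob m z \<le> \<epsilon> m"
    and sum_le: "\<And>n. (\<Sum>m<n. \<epsilon> m) \<le> K"
begin

lemma eps_nonneg: "x \<in> X \<Longrightarrow> 0 \<le> \<epsilon> m"
  using late_return_prob_bounds(1) late_le by (rule order_trans)

text \<open>Expanding the square, index \<open>n\<close> adds twice its covariances with the earlier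
  terms, at most \<open>2 * K\<close> because the gaps \<open>n - i\<close> are distinct, and a
  diagonal term of at most 1.\<close>

lemma second_moment_sum_centered_le:
  assumes x: "x \<in> X"
  shows "(\<integral>\<omega>. (\<Sum>i<n. centered i \<omega>)\<^sup>2 \<partial>P x) \<le> (2 * K + 1) * real n"
proof (induction n)
  case (Suc n)
  interpret prob_space "P x" using x by (rule prob_space_P)
  have i1: "integrable (P x) (\<lambda>\<omega>. (\<Sum>i<n. centered i \<omega>)\<^sup>2)"
  proof (rule integrable_bounded[OF x])
    show "\<bar>(\<Sum>i<n. centered i \<omega>)\<^sup>2\<bar> \<le> (real n)\<^sup>2" if "\<omega> \<in> space (P x)" for \<omega>
      using power_mono[OF abs_sum_centered_le[OF x that], of n 2] by simp
  qed (use x in measurable)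
  have i2: "integrable (P x) (\<lambda>\<omega>. centered i \<omega> * centered j \<omega>)" for i j
  proof (rule integrable_bounded[OF x])
    show "\<bar>centered i \<omega> * centered j \<omega>\<bar> \<le> 1 * 1" if "\<omega> \<in> space (P x)" for \<omega>
      unfolding abs_mult using abs_centered_le[OF x that] by (intro mult_mono) auto
  qed (use x in measurable)
  have "(\<Sum>i<Suc n. centered i \<omega>)\<^sup>2 = (\<Sum>i<n. centered i \<omega>)\<^sup>2
      + 2 * (\<Sum>i<n. centered i \<omega> * centered n \<omega>) + centered n \<omega> * centered n \<omega>" for \<omega>
    by (simp add: power2_eq_square algebra_simps sum_distrib_right[symmetric])
  then have "(\<integral>\<omega>. (\<Sum>i<Suc n. centered i \<omega>)\<^sup>2 \<partial>P x) = (\<integral>\<omega>. (\<Sum>i<n. centered i \<omega>)\<^sup>2 \<partial>P x)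
      + 2 * (\<Sum>i<n. \<integral>\<omega>. centered i \<omega> * centered n \<omega> \<partial>P x) + (\<integral>\<omega>. centered n \<omega> * centered n \<omega> \<partial>P x)"
    using i1 i2 by simp
  also have "(\<integral>\<omega>. centered n \<omega> * centered n \<omega> \<partial>P x) \<le> 1"
  proof (rule integral_le_const[OF i2], rule AE_I2)
    fix \<omega> assume "\<omega> \<in> space (P x)"
    then show "centered n \<omega> * centered n \<omega> \<le> 1"
      using abs_centered_le[OF x] by (metis abs_le_square_iff abs_one one_power2 power2_eq_square)
  qed
  \<comment> \<open>The gap \<open>n - i\<close> is written \<open>Suc (n - Suc i)\<close> to allow
    reversing the sum.\<close>
  also have "(\<Sum>i<n. \<integral>\<omega>. centered i \<omega> * centered n \<omega> \<partial>P x) \<le> (\<Sum>i<n. \<epsilon> (Suc (n - Suc i)))"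
  proof (rule sum_mono)
    fix i assume "i \<in> {..<n}"
    then have "i < n" "Suc (n - Suc i) = n - i" by auto
    then show "(\<integral>\<omega>. centered i \<omega> * centered n \<omega> \<partial>P x) \<le> \<epsilon> (Suc (n - Suc i))"
      using late_le by (intro expectation_centered_mult_le x) auto
  qed
  also have "(\<Sum>i<n. \<epsilon> (Suc (n - Suc i))) = (\<Sum>i<n. \<epsilon> (Suc i))"
    by (rule sum.nat_diff_reindex)
  also have "\<dots> \<le> (\<Sum>i<Suc n. \<epsilon> i)"
    unfolding sum.lessThan_Suc_shift using eps_nonneg[OF x] by simp
  also have "\<dots> \<le> K"
    by (rule sum_le)
  finally show ?case
    using Suc by (simp add: algebra_simps)
qed simp

text \<open>The difference splits into the fluctuation \<open>W\<close> of the centered terms and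
  the end correction \<open>D\<close>, which counts first returns at time \<open>n\<close> or later.
  Both contribute O(n) to the second moment.\<close>

theorem AE_walk_range_asymptotics:
  assumes x: "x \<in> X"
  shows "AE \<omega> in P x. (\<lambda>n. (real (walk_range S n \<omega>) - (\<Sum>i<n. 1 - late_return_prob 0 (S i \<omega>))) / real n) \<longlonglongrightarrow> 0"
proof -
  interpret prob_space "P x" using x by (rule prob_space_P)
  define U where "U n \<omega> = real (walk_range S n \<omega>) - (\<Sum>i<n. 1 - late_return_prob 0 (S i \<omega>))" for n \<omega>
  define W where "W n \<omega> = (\<Sum>i<n. centered i \<omega>)" for n \<omega>
  define D where "D n \<omega> = (\<Sum>i<n. late i (n - Suc i) \<omega>)" for n \<omega>
  have U_eq: "U n \<omega> = W n \<omega> + D n \<omega>" for n \<omega>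
    unfolding U_def walk_range_eq_sum W_def D_def sum.distrib[symmetric] sum_subtractf[symmetric]
    by (intro sum.cong) (auto simp: centered_def late_def)
  have meas [measurable]: "W n \<in> borel_measurable (P x)" "D n \<in> borel_measurable (P x)" for n
    unfolding W_def D_def using x by measurable
  have W_bound: "\<bar>W n \<omega>\<bar> \<le> real n" if "\<omega> \<in> space (P x)" for n \<omega>
    unfolding W_def by (rule abs_sum_centered_le[OF x that])
  have D_bound: "0 \<le> D n \<omega>" "D n \<omega> \<le> real n" for n \<omega>
    unfolding D_def using sum_bounded_above[of "{..<n}" "\<lambda>i. late i (n - Suc i) \<omega>" 1] late_bounds
    by (auto intro: sum_nonneg)
  have iW: "integrable (P x) (\<lambda>\<omega>. (W n \<omega>)\<^sup>2)" for n
    by (rule integrable_bounded[OF x, of _ "(real n)\<^sup>2"]) (use power_mono[OF W_bound, of _ n 2] in auto)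
  have iD: "integrable (P x) (D n)" for n
    by (rule integrable_bounded[OF x, of _ "real n"]) (use D_bound in auto)
  have iU: "integrable (P x) (\<lambda>\<omega>. (U n \<omega>)\<^sup>2)" for n
  proof (rule integrable_bounded[OF x])
    show "\<bar>(U n \<omega>)\<^sup>2\<bar> \<le> (2 * real n)\<^sup>2" if "\<omega> \<in> space (P x)" for \<omega>
    proof -
      have "\<bar>U n \<omega>\<bar> \<le> 2 * real n"
        using W_bound[OF that, of n] D_bound[of n \<omega>] by (simp add: U_eq)
      then show ?thesis
        using power_mono[of "\<bar>U n \<omega>\<bar>" "2 * real n" 2] by simp
    qed
  qed (simp add: U_eq)
  have "AE \<omega> in P x. (\<lambda>n. U n \<omega> / real n) \<longlonglongrightarrow> 0"
  proof (rule AE_tendsto_0_if_second_moment_linear[OF iU])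
    fix n
    \<comment> \<open>As \<open>D n\<close> lies between 0 and \<open>n\<close>, its square is at
      most \<open>n * D n\<close>, so a bound on the mean of \<open>D n\<close> suffices.\<close>
    have "(U n \<omega>)\<^sup>2 \<le> 2 * (W n \<omega>)\<^sup>2 + 2 * (real n * D n \<omega>)" for \<omega>
    proof -
      have "(D n \<omega>)\<^sup>2 \<le> real n * D n \<omega>"
        unfolding power2_eq_square using D_bound by (intro mult_right_mono) auto
      moreover have "(W n \<omega> + D n \<omega>)\<^sup>2 \<le> 2 * (W n \<omega>)\<^sup>2 + 2 * (D n \<omega>)\<^sup>2"
        using zero_le_power2[of "W n \<omega> - D n \<omega>"] by (simp add: power2_eq_square algebra_simps)
      ultimately show ?thesis by (simp add: U_eq)
    qed
    then have "expectation (\<lambda>\<omega>. (U n \<omega>)\<^sup>2) \<le> expectation (\<lambda>\<omega>. 2 * (W n \<omega>)\<^sup>2 + 2 * (real n * D n \<omega>))"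
      by (intro integral_mono iU Bochner_Integration.integrable_add integrable_mult_right iW iD)
    also have "\<dots> = 2 * expectation (\<lambda>\<omega>. (W n \<omega>)\<^sup>2) + 2 * (real n * expectation (D n))"
      using iW iD by simp
    also have "\<dots> \<le> 2 * ((2 * K + 1) * real n) + 2 * (real n * K)"
    proof (intro add_mono mult_left_mono)
      show "expectation (\<lambda>\<omega>. (W n \<omega>)\<^sup>2) \<le> (2 * K + 1) * real n"
        unfolding W_def by (rule second_moment_sum_centered_le[OF x])
      have "expectation (D n) = (\<Sum>i<n. \<integral>\<omega>. late i (n - Suc i) \<omega> \<partial>P x)"
        unfolding D_def
        by (rule Bochner_Integration.integral_sum)
          (rule integrable_bounded[OF x, of _ 1], use x late_bounds in auto)
      also have "\<dots> \<le> (\<Sum>i<n. \<epsilon> (n - Suc i))"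
        by (intro sum_mono expectation_late_le x late_le)
      also have "\<dots> = (\<Sum>m<n. \<epsilon> m)"
        by (rule sum.nat_diff_reindex)
      also have "\<dots> \<le> K"
        by (rule sum_le)
      finally show "expectation (D n) \<le> K" .
    qed auto
    also have "\<dots> = (6 * K + 2) * real n"
      by (simp add: algebra_simps)
    finally show "expectation (\<lambda>\<omega>. (U n \<omega>)\<^sup>2) \<le> (6 * K + 2) * real n" .
  next
    fix n \<omega> assume \<omega>: "\<omega> \<in> space (P x)"
    \<comment> \<open>One more step adds 0 or 1 to the range and a number in [0,1] to the subtracted
      sum, so the difference moves by at most 1.\<close>
    have "walk_range S n \<omega> \<le> walk_range S (Suc n) \<omega>" "walk_range S (Suc n) \<omega> \<le> Suc (walk_range S n \<omega>)"
      unfolding walk_range_def by (auto simp: lessThan_Suc card_insert_if)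
    then show "\<bar>U (Suc n) \<omega> - U n \<omega>\<bar> \<le> 1"
      using late_return_prob_bounds[OF S_in_X[OF x \<omega>], of 0 n] by (simp add: U_def abs_le_iff)
  qed
  then show ?thesis
    by (simp add: U_def)
qed

end

end

section \<open>From the tail hypothesis to the bounds with \<open>F1\<close> and
  \<open>F2\<close>\<close>

theorem corollary2p3:
  fixes X :: "'a set" and E :: "'a \<Rightarrow> 'a \<Rightarrow> bool" and \<mu> :: "'a \<Rightarrow> 'a \<Rightarrow> real"
    and P :: "'a \<Rightarrow> 'w measure" and S :: "nat \<Rightarrow> 'w \<Rightarrow> 'a"
    and \<delta> :: real and x :: 'a
  assumes "weighted_graph X E \<mu>"
    and "random_walk X \<mu> P S"
    and "\<delta> > 0"
    and "(\<lambda>M::nat. SUP z\<in>X. \<P>(\<omega> in P z. enat M < return_time S z \<omega> \<and> return_time S z \<omega> < \<infinity>))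
           \<in> O(\<lambda>M. real M powr (- 1 - \<delta>))"
    and "x \<in> X"
  shows "AE \<omega> in P x.
      ereal (1 - F2 X P S) \<le> liminf (\<lambda>n. ereal (real (walk_range S n \<omega>) / real n)) \<and>
      liminf (\<lambda>n. ereal (real (walk_range S n \<omega>) / real n))
        \<le> limsup (\<lambda>n. ereal (real (walk_range S n \<omega>) / real n)) \<and>
      limsup (\<lambda>n. ereal (real (walk_range S n \<omega>) / real n)) \<le> ereal (1 - F1 X P S)"
proof -
  interpret weighted_graph X E \<mu> by fact
  interpret random_walk X \<mu> P S by fact
  interpret countable_random_walk X \<mu> P S
    by unfold_locales (rule countable_vertices)
  note x = \<open>x \<in> X\<close>
  define \<epsilon> where "\<epsilon> m = (SUP z\<in>X. late_return_prob m z)" for m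
  have "\<epsilon> = (\<lambda>M. SUP z\<in>X. \<P>(\<omega> in P z. enat M < return_time S z \<omega> \<and> return_time S z \<omega> < \<infinity>))"
    unfolding \<epsilon>_def by (intro ext SUP_cong refl late_return_prob_eq)
  then have bigo: "\<epsilon> \<in> O(\<lambda>M. real M powr (- 1 - \<delta>))"
    using assms(4) by simp
  \<comment> \<open>Real-valued suprema and infima bound their members only for bounded sets;
    probabilities lie in [0,1].\<close>
  have bdd: "bdd_above (late_return_prob m ` X)" "bdd_below (late_return_prob m ` X)" for m
    using late_return_prob_bounds by (auto intro!: bdd_aboveI2[of _ _ 1] bdd_belowI2[of _ 0])
  have le: "late_return_prob m z \<le> \<epsilon> m" if "z \<in> X" for z m
    unfolding \<epsilon>_def using that bdd by (intro cSUP_upper)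
  \<comment> \<open>As \<delta> is positive, the exponent is below -1 and the comparison series
    converges; the sum of \<epsilon> then serves as \<open>K\<close>.\<close>
  have "summable \<epsilon>"
  proof (rule summable_comparison_test_bigo[OF _ bigo])
    show "summable (\<lambda>M. norm (real M powr (- 1 - \<delta>)))"
      using \<open>\<delta> > 0\<close> by (simp add: summable_real_powr_iff)
  qed
  moreover have "0 \<le> \<epsilon> m" for m
    using late_return_prob_bounds(1)[OF x] le[OF x] by (rule order_trans)
  ultimately have sum: "(\<Sum>m<n. \<epsilon> m) \<le> suminf \<epsilon>" for n
    by (intro sum_le_suminf) auto
  \<comment> \<open>Return times are at least 1, so \<open>m = 0\<close> imposes no lower
    bound.\<close>
  have return: "late_return_prob 0 z = \<P>(\<omega> in P z. return_time S z \<omega> < \<infinity>)" if "z \<in> X" for z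
  proof -
    have "0 < return_time S z \<omega>" for \<omega>
    proof -
      have "enat 1 \<le> return_time S z \<omega>"
        unfolding return_time_def by (rule INF_greatest) simp
      then show ?thesis
        by (rule less_le_trans[rotated]) (simp add: zero_enat_def)
    qed
    then show ?thesis
      using late_return_prob_eq[OF that, of 0] by (simp add: zero_enat_def[symmetric])
  qed
  have F: "F1 X P S \<le> late_return_prob 0 z" "late_return_prob 0 z \<le> F2 X P S" if "z \<in> X" for z
  proof -
    have "F1 X P S = (INF z\<in>X. late_return_prob 0 z)" "F2 X P S = (SUP z\<in>X. late_return_prob 0 z)"
      unfolding F1_def F2_def by (auto intro!: INF_cong SUP_cong simp: return)
    then show "F1 X P S \<le> late_return_prob 0 z" "late_return_prob 0 z \<le> F2 X P S"
      using that bdd by (auto intro: cINF_lower cSUP_upper)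
  qed
  have "AE \<omega> in P x. (\<lambda>n. (real (walk_range S n \<omega>) -
      (\<Sum>i<n. 1 - late_return_prob 0 (S i \<omega>))) / real n) \<longlonglongrightarrow> 0"
    by (rule AE_walk_range_asymptotics[where \<epsilon> = \<epsilon> and K = "suminf \<epsilon>"]) (fact le sum x)+
  then show ?thesis
    using AE_space
  proof eventually_elim
    case (elim \<omega>)
    define r where "r n = real (walk_range S n \<omega>) / real n" for n
    define u where "u n = (real (walk_range S n \<omega>) - (\<Sum>i<n. 1 - late_return_prob 0 (S i \<omega>))) / real n" for n
    have u: "u \<longlonglongrightarrow> 0"
      using elim(1) unfolding u_def .
    \<comment> \<open>The average of \<open>1 - p (S i)\<close> lies between the two constants, and
      \<open>r n\<close> is \<open>u n\<close> plus this average; \<open>0 < n\<close> rules out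
      division by zero.\<close>
    have bounds: "u n + (1 - F2 X P S) \<le> r n \<and> r n \<le> u n + (1 - F1 X P S)" if "0 < n" for n
    proof -
      have "real n * (1 - F2 X P S) \<le> (\<Sum>i<n. 1 - late_return_prob 0 (S i \<omega>))"
        using sum_bounded_below[of "{..<n}" "1 - F2 X P S" "\<lambda>i. 1 - late_return_prob 0 (S i \<omega>)"]
          F(2)[OF S_in_X[OF x]] elim by simp
      moreover have "(\<Sum>i<n. 1 - late_return_prob 0 (S i \<omega>)) \<le> real n * (1 - F1 X P S)"
        using sum_bounded_above[of "{..<n}" "\<lambda>i. 1 - late_return_prob 0 (S i \<omega>)" "1 - F1 X P S"]
          F(1)[OF S_in_X[OF x]] elim by simp
      ultimately have "1 - F2 X P S \<le> (\<Sum>i<n. 1 - late_return_prob 0 (S i \<omega>)) / real n"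
        "(\<Sum>i<n. 1 - late_return_prob 0 (S i \<omega>)) / real n \<le> 1 - F1 X P S"
        using that by (simp_all add: pos_le_divide_eq pos_divide_le_eq mult.commute)
      then show ?thesis
        unfolding r_def u_def diff_divide_distrib by linarith
    qed
    have lim: "(\<lambda>n. ereal (u n + c)) \<longlonglongrightarrow> ereal c" for c
      using tendsto_add[OF u tendsto_const[of c]] by simp
    have "ereal (1 - F2 X P S) = liminf (\<lambda>n. ereal (u n + (1 - F2 X P S)))"
      using lim_imp_Liminf[OF _ lim] by simp
    also have "\<dots> \<le> liminf (\<lambda>n. ereal (r n))"
      by (intro Liminf_mono eventually_mono[OF eventually_gt_at_top[of 0]]) (use bounds in simp)
    finally have "ereal (1 - F2 X P S) \<le> liminf (\<lambda>n. ereal (r n))" .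
    moreover have "liminf (\<lambda>n. ereal (r n)) \<le> limsup (\<lambda>n. ereal (r n))"
      by (rule Liminf_le_Limsup) simp
    moreover have "limsup (\<lambda>n. ereal (r n)) \<le> limsup (\<lambda>n. ereal (u n + (1 - F1 X P S)))"
      by (intro Limsup_mono eventually_mono[OF eventually_gt_at_top[of 0]]) (use bounds in simp)
    moreover have "\<dots> = ereal (1 - F1 X P S)"
      using lim_imp_Limsup[OF _ lim] by simp
    ultimately show ?case
      by (simp add: r_def)
  qed
qed

end
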